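(* Let $G$ be the square lattice on $n\times n=N$ vertices. Then \[ \lim_{N\to\infty}\frac{\sup_{p\in(0,1)}\mathbb{E}[C_p]}{N}\in(0.12953,\,0.13268), \] where the limit is taken along $N=n^2$, $n\to\infty$.
   Context: The square lattice on $n\times n$ vertices is the graph with vertex set $\{1,\ldots,n\}^2$ in which two vertices are adjacent iff they are at Euclidean distance $1$. For a graph $G$ and $p\in[0,1]$, each vertex of $G$ is declared open with probability $p$ and closed with probability $1-p$, independently of the other vertices; $G_p$ is the subgraph of $G$ induced by the open vertices, and $C_p$ is the number of connected components of $G_p$. *)

theory Defs
  imports "HOL-Probability.Product_PMF" "Graph_Theory.Digraph_Component"
begin

(* An undirected graph is a symmetric digraph, with each edge represented by both of its
   orientations. *)
definition square_lattice :: "nat \<Rightarrow> (nat \<times> nat) pair_pre_digraph" where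
  "square_lattice n =
    \<lparr> pverts = {1..n} \<times> {1..n},
      parcs = {(u, v). u \<in> {1..n} \<times> {1..n} \<and> v \<in> {1..n} \<times> {1..n} \<and>
        dist (map_prod real real u) (map_prod real real v) = 1} \<rparr>"

(* "connected" is qualified because the topological notion has the same base name.  The empty
   graph is not connected, so it has no components. *)
definition components :: "('a, 'b) pre_digraph \<Rightarrow> ('a, 'b) pre_digraph set" where
  "components G = {H. pre_digraph.max_subgraph G Digraph_Component.connected H}"

(* The random set of open vertices; vertices outside G are closed. *)
definition site_percolation :: "('a, 'b) pre_digraph \<Rightarrow> real \<Rightarrow> ('a \<Rightarrow> bool) pmf" where
  "site_percolation G p = Pi_pmf (verts G) False (\<lambda>_. bernoulli_pmf p)"

definition open_subgraph :: "('a, 'b) pre_digraph \<Rightarrow> ('a \<Rightarrow> bool) \<Rightarrow> ('a, 'b) pre_digraph" where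
  "open_subgraph G \<omega> = G \<restriction> {v \<in> verts G. \<omega> v}"

definition expected_components :: "('a, 'b) pre_digraph \<Rightarrow> real \<Rightarrow> real" where
  "expected_components G p =
    measure_pmf.expectation (site_percolation G p) (\<lambda>\<omega>. real (card (components (open_subgraph G \<omega>))))"

lemma pair_graph_square_lattice: "pair_graph (square_lattice n)"
proof
  fix e assume e: "e \<in> parcs (square_lattice n)"
  show "fst e \<in> pverts (square_lattice n)" "snd e \<in> pverts (square_lattice n)"
    using e by (auto simp: square_lattice_def)
  show "fst e \<noteq> snd e"
    using e by (auto simp: square_lattice_def)
next
  show "finite (pverts (square_lattice n))"
    by (simp add: square_lattice_def)
  show "finite (parcs (square_lattice n))"
    by (rule finite_subset[of _ "({1..n} \<times> {1..n}) \<times> ({1..n} \<times> {1..n})"])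
      (auto simp: square_lattice_def)
  show "symmetric (square_lattice n)"
    by (auto simp: symmetric_def square_lattice_def sym_def dist_commute)
qed

lemma components_eq_sccs:
  assumes "sym_digraph G"
  shows "components G = pre_digraph.sccs G"
proof -
  interpret G: sym_digraph G by fact
  have conn: "Digraph_Component.connected H \<longleftrightarrow> strongly_connected H"
    if "induced_subgraph H G" for H
  proof -
    interpret H: wf_digraph H using that by (rule wf_digraphI_induced)
    show ?thesis
      using H.reachable_mk_symmetric_eq[OF induced_graph_imp_symmetric[OF G.sym_arcs that]]
      by (simp add: Digraph_Component.connected_def strongly_connected_def)
  qed
  have sc: "Digraph_Component.connected H" if "subgraph H G" "strongly_connected H" for H
  proof -
    interpret H: wf_digraph H using that(1) by blast
    show ?thesis
      using that(2) H.reachable_mk_symmetricI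
      by (auto simp: Digraph_Component.connected_def strongly_connected_def)
  qed
  have ind: "induced_subgraph (G \<restriction> verts H) G \<and> subgraph H (G \<restriction> verts H) \<and>
      Digraph_Component.connected (G \<restriction> verts H)"
    if H: "subgraph H G" "Digraph_Component.connected H" for H
  proof -
    have 1: "induced_subgraph (G \<restriction> verts H) G"
      using H(1) by (intro G.induced_induce) auto
    then interpret GH: wf_digraph "G \<restriction> verts H" by (rule wf_digraphI_induced)
    interpret H: wf_digraph H using H(1) by blast
    have "tail G = tail H" "head G = head H" "arcs H \<subseteq> arcs G"
      using H(1) by (auto simp: subgraph_def compatible_def)
    then have 2: "subgraph H (G \<restriction> verts H)"
      using H.wf_digraph GH.wf_digraph H.tail_in_verts H.head_in_verts
      by (auto simp: subgraph_def compatible_def)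
    then have "spanning H (G \<restriction> verts H)" by (simp add: spanning_def)
    then show ?thesis using 1 2 H(2) GH.connected_spanning_imp_connected by blast
  qed
  have "pre_digraph.max_subgraph G Digraph_Component.connected H \<longleftrightarrow>
      pre_digraph.max_subgraph G strongly_connected H" (is "?c \<longleftrightarrow> ?s") for H
  proof
    assume c: ?c
    then have H: "subgraph H G" "Digraph_Component.connected H"
      by (auto simp: G.max_subgraph_def)
    then have "G \<restriction> verts H = H"
      using c ind[OF H] by (metis G.max_subgraph_def induced_imp_subgraph)
    then have "strongly_connected H" using ind[OF H] conn by metis
    then show ?s using c sc unfolding G.max_subgraph_def by metis
  next
    assume s: ?s
    then have H: "subgraph H G" "strongly_connected H"
      by (auto simp: G.max_subgraph_def)
    have "K = H" if K: "subgraph H K" "subgraph K G" "Digraph_Component.connected K" for K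
    proof -
      have "subgraph H (G \<restriction> verts K)"
        using ind[OF K(2,3)] K(1) by (metis subgraph_trans)
      moreover have "subgraph (G \<restriction> verts K) G" "strongly_connected (G \<restriction> verts K)"
        using ind[OF K(2,3)] conn induced_imp_subgraph by blast+
      ultimately have "G \<restriction> verts K = H"
        using s unfolding G.max_subgraph_def by metis
      then show ?thesis
        using ind[OF K(2,3)] K(1)
        by (intro pre_digraph.equality) (auto simp: subgraph_def compatible_def)
    qed
    then show ?c using H sc unfolding G.max_subgraph_def by metis
  qed
  then show ?thesis by (simp add: components_def G.sccs_altdef2)
qed

end

theory Submission
  imports Defs
begin

text \<open>Subadditivity of the number of clusters under unions of vertex sets gives the existence of the
  limit, as an infimum over the side length.

  For the numerical bounds, add the open sites in the order of increasing \<open>i + 2 * j\<close>. A new site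
  \<open>v = (i, j)\<close> only has its left neighbour \<open>W\<close> and its lower neighbour \<open>S\<close> in the past, so the number
  of clusters is the sum over open \<open>v\<close> of \<open>1 - [W open] - [S open] + [W and S connected in the past]\<close>.
  If \<open>W\<close> and \<open>S\<close> are open, they are connected in the past when the site \<open>(i - 1, j - 1)\<close> is open, or
  when it is closed but its other neighbours are open, in the wide sense including diagonals.
  Conversely, if \<open>(i - 1, j - 1)\<close> is closed, a connection requires \<open>(i - 2, j)\<close> and one of
  \<open>(i + 1, j - 1)\<close>, \<open>(i, j - 2)\<close> to be open. With \<open>q = 1 - p\<close>, the number of clusters per site thus lies
  between \<open>p - 2p\<^sup>2 + p\<^sup>4 + q p\<^sup>8\<close> and \<open>p - 2p\<^sup>2 + p\<^sup>4 + q p\<^sup>5 (1 + q)\<close>, up to boundary terms.\<close>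

section \<open>Clusters of a vertex set and how their number changes\<close>

text \<open>Since \<open>rtrancl_on A E\<close> only passes through vertices of \<open>A\<close>,
  the relation can stay fixed while the set of open sites varies. For symmetric \<open>E\<close> the
  classes partition \<open>A\<close>.\<close>

definition clusters :: "'a rel \<Rightarrow> 'a set \<Rightarrow> 'a set set" where
  "clusters E A = (\<lambda>x. rtrancl_on A E `` {x}) ` A"

lemma finite_clusters: "finite A \<Longrightarrow> finite (clusters E A)"
  by (simp add: clusters_def)

lemma rtrancl_on_class_eq_iff:
  assumes "sym E" "x \<in> A" "y \<in> A"
  shows "rtrancl_on A E `` {x} = rtrancl_on A E `` {y} \<longleftrightarrow> (x, y) \<in> rtrancl_on A E"
proof
  assume "rtrancl_on A E `` {x} = rtrancl_on A E `` {y}"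
  then have "y \<in> rtrancl_on A E `` {x}" using assms(3) by simp
  then show "(x, y) \<in> rtrancl_on A E" by simp
next
  assume xy: "(x, y) \<in> rtrancl_on A E"
  then have "(y, x) \<in> rtrancl_on A E" using rtrancl_on_sym[OF assms(1), of A] by (rule symD[rotated])
  then show "rtrancl_on A E `` {x} = rtrancl_on A E `` {y}"
    using xy rtrancl_on_trans[of _ _ A E] by blast
qed

text \<open>Induction along the path: a vertex already reached inside \<open>A\<close> is not
  adjacent to \<open>x\<close> by assumption, so the next step cannot enter
  \<open>x\<close>.\<close>

lemma rtrancl_on_insert_avoid:
  assumes "(u, v) \<in> rtrancl_on (insert x A) E" "u \<in> A" "sym E"
    and "\<And>z. (u, z) \<in> rtrancl_on A E \<Longrightarrow> (x, z) \<notin> E"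
  shows "(u, v) \<in> rtrancl_on A E"
  using assms(1)
proof (induction rule: rtrancl_on_induct)
  case base
  then show ?case using assms(2) by simp
next
  case (step y z)
  then have "z \<noteq> x" using assms(3,4) by (metis symD)
  then show ?case using step by (auto intro: rtrancl_on_into_rtrancl_on)
qed

text \<open>The vertex \<open>x\<close> fuses the clusters that contain one of its neighbours into a
  single cluster and leaves all others untouched. The additive form avoids subtraction of
  naturals.\<close>

lemma card_clusters_insert:
  assumes E: "sym E" and A: "finite A" "x \<notin> A"
  shows "card (clusters E (insert x A)) + card ((\<lambda>y. rtrancl_on A E `` {y}) ` {y \<in> A. (x, y) \<in> E})
    = card (clusters E A) + 1"
proof -
  let ?cl = "\<lambda>y. rtrancl_on A E `` {y}" and ?cl' = "\<lambda>y. rtrancl_on (insert x A) E `` {y}"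
  define N where "N = ?cl ` {y \<in> A. (x, y) \<in> E}"
  have mono: "(u, v) \<in> rtrancl_on (insert x A) E" if "(u, v) \<in> rtrancl_on A E" for u v
    using that rtrancl_on_mono[of E E A "insert x A"] by auto
  have NC: "N \<subseteq> clusters E A" by (auto simp: N_def clusters_def)
  have same: "?cl' y = ?cl y" if "y \<in> A" "?cl y \<notin> N" for y
  proof -
    have "(x, z) \<notin> E" if "(y, z) \<in> rtrancl_on A E" for z
      using that \<open>?cl y \<notin> N\<close> \<open>y \<in> A\<close> rtrancl_on_class_eq_iff[OF E \<open>y \<in> A\<close>, of z]
        in_rtrancl_on_in_F(2)[OF that]
      by (auto simp: N_def)
    then show ?thesis using rtrancl_on_insert_avoid[OF _ that(1) E] mono by blast
  qed
  have merged: "?cl' y = ?cl' x" if "y \<in> A" "?cl y \<in> N" for y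
  proof -
    from that obtain z where z: "z \<in> A" "(x, z) \<in> E" "?cl y = ?cl z" by (auto simp: N_def)
    then have "(z, y) \<in> rtrancl_on A E" using rtrancl_on_class_eq_iff[OF E, of z A y] that by simp
    then have "(x, y) \<in> rtrancl_on (insert x A) E"
      using z mono by (metis converse_rtrancl_on_into_rtrancl_on insertI1)
    then show ?thesis using rtrancl_on_class_eq_iff[OF E, of x "insert x A" y] that by simp
  qed
  have "clusters E (insert x A) = insert (?cl' x) (clusters E A - N)"
  proof (intro equalityI subsetI)
    fix c assume "c \<in> clusters E (insert x A)"
    then consider "c = ?cl' x" | y where "y \<in> A" "c = ?cl' y" by (auto simp: clusters_def)
    then show "c \<in> insert (?cl' x) (clusters E A - N)"
    proof cases
      case 2
      then show ?thesis using same[of y] merged[of y]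
        by (cases "?cl y \<in> N") (auto simp: clusters_def)
    qed simp
  next
    fix c assume "c \<in> insert (?cl' x) (clusters E A - N)"
    then consider "c = ?cl' x" | y where "y \<in> A" "c = ?cl y" "?cl y \<notin> N" by (auto simp: clusters_def)
    then show "c \<in> clusters E (insert x A)"
    proof cases
      case 2
      then have "c = ?cl' y" using same[of y] by simp
      then show ?thesis using 2(1) by (auto simp: clusters_def)
    qed (simp add: clusters_def)
  qed
  moreover have "?cl' x \<notin> clusters E A"
  proof
    assume "?cl' x \<in> clusters E A"
    then obtain y where "?cl' x = ?cl y" unfolding clusters_def by blast
    moreover have "x \<in> ?cl' x" by simp
    ultimately have "(y, x) \<in> rtrancl_on A E" by blast
    then show False using A in_rtrancl_on_in_F(2) by metis
  qed
  ultimately have "card (clusters E (insert x A)) = Suc (card (clusters E A - N))"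
    using A by (simp add: finite_clusters)
  moreover have "card (clusters E A - N) + card N = card (clusters E A)"
    using NC A finite_clusters[OF A(1), of E]
    by (metis card_Diff_subset card_mono finite_subset le_add_diff_inverse2)
  ultimately show ?thesis by (simp add: N_def)
qed

text \<open>Saturating a cluster of \<open>A\<close> or \<open>B\<close> inside the union yields a
  cluster of the union, and every cluster of the union arises in this way from any of its points. So
  \<open>?g\<close> maps onto the clusters of the union.\<close>

lemma card_clusters_Un_le:
  assumes E: "sym E" and fin: "finite A" "finite B"
  shows "card (clusters E (A \<union> B)) \<le> card (clusters E A) + card (clusters E B)"
proof -
  let ?g = "\<lambda>C. rtrancl_on (A \<union> B) E `` C"
  have *: "?g (rtrancl_on A' E `` {y}) = rtrancl_on (A \<union> B) E `` {y}"
    if "y \<in> A'" "A' \<subseteq> A \<union> B" for A' y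
  proof -
    have 1: "(u, v) \<in> rtrancl_on (A \<union> B) E" if "(u, v) \<in> rtrancl_on A' E" for u v
      using that \<open>A' \<subseteq> A \<union> B\<close> rtrancl_on_mono[of E E A' "A \<union> B"] by blast
    show ?thesis
    proof (intro equalityI subsetI)
      fix z assume "z \<in> ?g (rtrancl_on A' E `` {y})"
      then show "z \<in> rtrancl_on (A \<union> B) E `` {y}" using 1 rtrancl_on_trans[of y _ "A \<union> B" E z] by blast
    next
      fix z assume "z \<in> rtrancl_on (A \<union> B) E `` {y}"
      moreover have "y \<in> rtrancl_on A' E `` {y}" using that by simp
      ultimately show "z \<in> ?g (rtrancl_on A' E `` {y})" by blast
    qed
  qed
  have "clusters E (A \<union> B) \<subseteq> ?g ` (clusters E A \<union> clusters E B)"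
  proof
    fix C assume "C \<in> clusters E (A \<union> B)"
    then obtain y where y: "y \<in> A \<or> y \<in> B" "C = rtrancl_on (A \<union> B) E `` {y}"
      unfolding clusters_def by blast
    then obtain A' where A': "A' = A \<or> A' = B" "y \<in> A'" by blast
    then have "C = ?g (rtrancl_on A' E `` {y})" using *[of y A'] y(2) by blast
    then show "C \<in> ?g ` (clusters E A \<union> clusters E B)"
      using A' unfolding clusters_def by blast
  qed
  then have "card (clusters E (A \<union> B)) \<le> card (clusters E A \<union> clusters E B)"
    using fin by (meson finite_UnI finite_clusters surj_card_le)
  then show ?thesis using card_Un_le order_trans by blast
qed

lemma card_clusters_le: "finite A \<Longrightarrow> card (clusters E A) \<le> card A"
  by (simp add: clusters_def card_image_le)

lemma rtrancl_on_image:
  assumes "(u, v) \<in> rtrancl_on A E" "\<And>a b. (a, b) \<in> E \<Longrightarrow> (f a, f b) \<in> E"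
  shows "(f u, f v) \<in> rtrancl_on (f ` A) E"
  using assms(1)
  by (induction rule: rtrancl_on_induct) (auto intro: rtrancl_on_into_rtrancl_on assms(2))

lemma rtrancl_on_imageD:
  assumes "(u', v') \<in> rtrancl_on (f ` A) E" "inj f" "\<And>a b. (f a, f b) \<in> E \<Longrightarrow> (a, b) \<in> E"
    "u' = f u"
  shows "\<exists>v. v' = f v \<and> (u, v) \<in> rtrancl_on A E"
  using assms(1,4)
proof (induction rule: rtrancl_on_induct)
  case base
  then show ?case using assms(2) by (auto simp: inj_image_mem_iff)
next
  case (step y z)
  then obtain v w where "y = f v" "(u, v) \<in> rtrancl_on A E" "z = f w" "w \<in> A" by blast
  then show ?case using step(2) assms(3) by (blast intro: rtrancl_on_into_rtrancl_on)
qed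

lemma card_clusters_image:
  assumes "inj f" "\<And>a b. (f a, f b) \<in> E \<longleftrightarrow> (a, b) \<in> E"
  shows "card (clusters E (f ` A)) = card (clusters E A)"
proof -
  have "rtrancl_on (f ` A) E `` {f x} = f ` (rtrancl_on A E `` {x})" for x
    using rtrancl_on_image[of x _ A E f] rtrancl_on_imageD[of "f x" _ f A E x] assms by fast
  then have "clusters E (f ` A) = (`) f ` clusters E A"
    by (simp add: clusters_def image_image)
  then show ?thesis using assms(1)
    by (metis card_image inj_image_eq_iff inj_onI)
qed

definition lattice_adj :: "(nat \<times> nat) rel" where
  "lattice_adj = {(u, v). dist (map_prod real real u) (map_prod real real v) = 1}"

text \<open>For integer differences, distance one means \<open>x\<^sup>2 + y\<^sup>2 = 1\<close>,
  whose only integer solutions are the four unit vectors.\<close>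

lemma lattice_adj_iff:
  "((a, b), (c, d)) \<in> lattice_adj \<longleftrightarrow>
    a = c \<and> (b = Suc d \<or> d = Suc b) \<or> b = d \<and> (a = Suc c \<or> c = Suc a)" (is "_ \<longleftrightarrow> ?r")
proof -
  define x y where "x = int a - int c" and "y = int b - int d"
  have "((a, b), (c, d)) \<in> lattice_adj \<longleftrightarrow> (real_of_int x)\<^sup>2 + (real_of_int y)\<^sup>2 = 1"
    by (simp add: lattice_adj_def dist_prod_def dist_real_def x_def y_def)
  also have "\<dots> \<longleftrightarrow> x\<^sup>2 + y\<^sup>2 = 1"
    using of_int_eq_1_iff[of "x\<^sup>2 + y\<^sup>2", where ?'a = real] by simp
  also have "\<dots> \<longleftrightarrow> x = 0 \<and> \<bar>y\<bar> = 1 \<or> y = 0 \<and> \<bar>x\<bar> = 1"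
  proof
    assume s: "x\<^sup>2 + y\<^sup>2 = 1"
    have "\<bar>x\<bar> \<le> 1" "\<bar>y\<bar> \<le> 1"
      using s zero_le_power2[of x] zero_le_power2[of y] abs_square_le_1[of x] abs_square_le_1[of y]
      by linarith+
    then have "x \<in> {-1, 0, 1}" "y \<in> {-1, 0, 1}" by auto
    then show "x = 0 \<and> \<bar>y\<bar> = 1 \<or> y = 0 \<and> \<bar>x\<bar> = 1" using s by auto
  next
    assume "x = 0 \<and> \<bar>y\<bar> = 1 \<or> y = 0 \<and> \<bar>x\<bar> = 1"
    then show "x\<^sup>2 + y\<^sup>2 = 1" by (metis add_0 add.right_neutral power2_abs power_one zero_power2)
  qed
  also have "\<dots> \<longleftrightarrow> ?r" by (auto simp: x_def y_def)
  finally show ?thesis .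
qed

lemma sym_lattice_adj: "sym lattice_adj"
  by (auto simp: sym_def lattice_adj_iff)

section \<open>Local densities and the site-by-site exploration\<close>

text \<open>Indicator of a cylinder event, \<open>A\<close> being the set of open sites. Under the
  product law its expectation is a monomial in \<open>p\<close> and \<open>1 - p\<close>.\<close>

definition cyl :: "'a set \<Rightarrow> 'a set \<Rightarrow> 'a set \<Rightarrow> real" where
  "cyl P Q A = of_bool (P \<subseteq> A \<and> Q \<inter> A = {})"

text \<open>In the last term, the open sites other than \<open>(i, j)\<close> are the seven
  remaining neighbours, in the wide sense, of the closed site \<open>(i - 1, j - 1)\<close>. They
  form a detour from the left to the lower neighbour of \<open>(i, j)\<close>.\<close>

definition low_density :: "nat \<times> nat \<Rightarrow> (nat \<times> nat) set \<Rightarrow> real" where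
  "low_density = (\<lambda>(i, j) A.
     cyl {(i, j)} {} A - cyl {(i, j), (i - 1, j)} {} A - cyl {(i, j), (i, j - 1)} {} A
     + cyl {(i, j), (i - 1, j), (i, j - 1), (i - 1, j - 1)} {} A
     + cyl {(i, j), (i - 1, j), (i, j - 1), (i - 2, j), (i - 2, j - 1), (i - 2, j - 2),
            (i - 1, j - 2), (i, j - 2)} {(i - 1, j - 1)} A)"

text \<open>The last two terms split the event that \<open>(i + 1, j - 1)\<close> or
  \<open>(i, j - 2)\<close> is open according to the state of \<open>(i + 1, j - 1)\<close>. This
  makes the two cylinder events disjoint, so that their indicators add up.\<close>

definition high_density :: "nat \<times> nat \<Rightarrow> (nat \<times> nat) set \<Rightarrow> real" where
  "high_density = (\<lambda>(i, j) A.
     cyl {(i, j)} {} A - cyl {(i, j), (i - 1, j)} {} A - cyl {(i, j), (i, j - 1)} {} A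
     + cyl {(i, j), (i - 1, j), (i, j - 1), (i - 1, j - 1)} {} A
     + cyl {(i, j), (i - 1, j), (i, j - 1), (i - 2, j), (i + 1, j - 1)} {(i - 1, j - 1)} A
     + cyl {(i, j), (i - 1, j), (i, j - 1), (i - 2, j), (i, j - 2)}
           {(i - 1, j - 1), (i + 1, j - 1)} A)"

text \<open>All other sites inspected by the densities at \<open>(i, j)\<close> precede it in the order by \<open>i + 2 * j\<close>,
  whereas \<open>(i - 1, j + 1)\<close> does not. Truncated subtraction is harmless because sites with a zero
  coordinate are never open.\<close>

lemma card_clusters_step:
  assumes A: "finite A" "(i, j) \<notin> A" "insert (i, j) A \<subseteq> {1..} \<times> {1..}"
    and rank: "\<And>a b. (a, b) \<in> A \<Longrightarrow> a + 2 * b \<le> i + 2 * j"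
  shows "real (card (clusters lattice_adj (insert (i, j) A))) = real (card (clusters lattice_adj A))
    + 1 - of_bool ((i - 1, j) \<in> A) - of_bool ((i, j - 1) \<in> A)
    + of_bool ((i - 1, j) \<in> A \<and> (i, j - 1) \<in> A \<and>
        ((i - 1, j), (i, j - 1)) \<in> rtrancl_on A lattice_adj)"
proof -
  let ?W = "(i - 1, j)" and ?S = "(i, j - 1)"
  let ?cl = "\<lambda>y. rtrancl_on A lattice_adj `` {y}"
  have pos: "i \<ge> 1" "j \<ge> 1" using A(3) by auto
  \<comment> \<open>The right and upper neighbours of \<open>(i, j)\<close> have rank larger by one
    and two, so \<open>rank\<close> keeps them out of \<open>A\<close>.\<close>
  have "{y \<in> A. ((i, j), y) \<in> lattice_adj} = {y \<in> {?W, ?S}. y \<in> A}"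
  proof (intro equalityI subsetI)
    fix y assume "y \<in> {y \<in> A. ((i, j), y) \<in> lattice_adj}"
    then obtain a b where y: "y = (a, b)" "(a, b) \<in> A" "((i, j), (a, b)) \<in> lattice_adj"
      by (cases y) auto
    then show "y \<in> {y \<in> {?W, ?S}. y \<in> A}"
      using rank[OF y(2)] by (auto simp: lattice_adj_iff)
  next
    fix y assume "y \<in> {y \<in> {?W, ?S}. y \<in> A}"
    then show "y \<in> {y \<in> A. ((i, j), y) \<in> lattice_adj}"
      using pos by (auto simp: lattice_adj_iff)
  qed
  then have "real (card (clusters lattice_adj (insert (i, j) A))) +
      real (card (?cl ` {y \<in> {?W, ?S}. y \<in> A})) = real (card (clusters lattice_adj A)) + 1"
    using arg_cong[OF card_clusters_insert[OF sym_lattice_adj A(1,2)], of real] by simp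
  moreover have "real (card (?cl ` {y \<in> {?W, ?S}. y \<in> A})) =
      of_bool (?W \<in> A) + of_bool (?S \<in> A) -
      of_bool (?W \<in> A \<and> ?S \<in> A \<and> (?W, ?S) \<in> rtrancl_on A lattice_adj)"
  proof -
    have *: "{y \<in> {?W, ?S}. y \<in> A} =
      (if ?W \<in> A then {?W} else {}) \<union> (if ?S \<in> A then {?S} else {})" by auto
    show ?thesis
      unfolding * using rtrancl_on_class_eq_iff[OF sym_lattice_adj, of ?W A ?S]
      by (auto simp: card_insert_if)
  qed
  ultimately show ?thesis by linarith
qed

text \<open>An explicit path is given: of two steps through \<open>(i - 1, j - 1)\<close>, or of six
  steps around it.\<close>

lemma past_connection_low:
  assumes "(i, j) \<notin> A" "i \<ge> 1" "j \<ge> 1"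
    and A: "A \<subseteq> {1..} \<times> {1..}"
    and "(i - 1, j) \<in> A" "(i, j - 1) \<in> A"
    and "(i - 1, j - 1) \<in> A \<or>
      {(i - 2, j), (i - 2, j - 1), (i - 2, j - 2), (i - 1, j - 2), (i, j - 2)} \<subseteq> A"
  shows "((i - 1, j), (i, j - 1)) \<in> rtrancl_on A lattice_adj"
  using assms(7)
proof
  have ij: "i \<ge> 2" "j \<ge> 2" using assms(2-6) by fastforce+
  {
    assume sw: "(i - 1, j - 1) \<in> A"
    have "((i - 1, j), (i - 1, j - 1)) \<in> lattice_adj" "((i - 1, j - 1), (i, j - 1)) \<in> lattice_adj"
      using ij by (auto simp: lattice_adj_iff)
    then show ?thesis
      using sw assms(5,6) by (meson converse_rtrancl_on_into_rtrancl_on rtrancl_on_refl)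
  next
    assume h: "{(i - 2, j), (i - 2, j - 1), (i - 2, j - 2), (i - 1, j - 2), (i, j - 2)} \<subseteq> A"
    \<comment> \<open>Sites of \<open>A\<close> have positive coordinates, so none of the
      differences below is truncated.\<close>
    then have "i \<ge> 3" "j \<ge> 3" using A by fastforce+
    then have "((i - 1, j), (i - 2, j)) \<in> lattice_adj" "((i - 2, j), (i - 2, j - 1)) \<in> lattice_adj"
      "((i - 2, j - 1), (i - 2, j - 2)) \<in> lattice_adj" "((i - 2, j - 2), (i - 1, j - 2)) \<in> lattice_adj"
      "((i - 1, j - 2), (i, j - 2)) \<in> lattice_adj" "((i, j - 2), (i, j - 1)) \<in> lattice_adj"
      by (auto simp: lattice_adj_iff)
    then show ?thesis
      using h assms(5,6) by (meson converse_rtrancl_on_into_rtrancl_on rtrancl_on_refl insert_subset)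
  }
qed

text \<open>A path must leave the first site and enter the last. The neighbours
  \<open>(i, j)\<close> and \<open>(i - 1, j - 1)\<close> are not in \<open>A\<close>, and
  \<open>(i - 1, j + 1)\<close> has too large a rank. This leaves one exit from
  \<open>(i - 1, j)\<close> and two from \<open>(i, j - 1)\<close>.\<close>

lemma past_connection_high:
  assumes "(i, j) \<notin> A" "i \<ge> 1" "j \<ge> 1"
    and A: "A \<subseteq> {1..} \<times> {1..}"
    and rank: "\<And>a b. (a, b) \<in> A \<Longrightarrow> a + 2 * b \<le> i + 2 * j"
    and "(i - 1, j) \<in> A" "(i, j - 1) \<in> A" "(i - 1, j - 1) \<notin> A"
    and conn: "((i - 1, j), (i, j - 1)) \<in> rtrancl_on A lattice_adj"
  shows "(i - 2, j) \<in> A \<and> ((i + 1, j - 1) \<in> A \<or> (i, j - 2) \<in> A)"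
proof
  have ij: "i \<ge> 2" "j \<ge> 2" using assms(2-7) by fastforce+
  show "(i - 2, j) \<in> A"
    using conn
  proof (cases rule: converse_rtrancl_on_cases)
    case base
    then show ?thesis using ij by auto
  next
    case (step c)
    obtain a b where c: "c = (a, b)" by fastforce
    have "(a, b) \<in> A" using step(2) in_rtrancl_on_in_F(1) c by fastforce
    then have "(a, b) \<noteq> (i, j)" "(a, b) \<noteq> (i - 1, j - 1)" "a + 2 * b \<le> i + 2 * j"
      using assms(1,8) rank by auto
    then have "a = i - 2 \<and> b = j" using step(1) ij c by (auto simp: lattice_adj_iff)
    then show ?thesis using \<open>(a, b) \<in> A\<close> by simp
  qed
  have conn': "((i, j - 1), (i - 1, j)) \<in> rtrancl_on A lattice_adj"
    using conn rtrancl_on_sym[OF sym_lattice_adj] by (meson symD)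
  show "(i + 1, j - 1) \<in> A \<or> (i, j - 2) \<in> A"
    using conn'
  proof (cases rule: converse_rtrancl_on_cases)
    case base
    then show ?thesis using ij by auto
  next
    case (step c)
    obtain a b where c: "c = (a, b)" by fastforce
    have ab: "(a, b) \<in> A" using step(2) in_rtrancl_on_in_F(1) c by fastforce
    then have "(a, b) \<noteq> (i, j)" "(a, b) \<noteq> (i - 1, j - 1)"
      using assms(1,8) rank by auto
    then have "a = i + 1 \<and> b = j - 1 \<or> a = i \<and> b = j - 2"
      using step(1) ij c by (auto simp: lattice_adj_iff)
    then show ?thesis using ab by auto
  qed
qed

lemma cyl_insert_future:
  assumes "x \<notin> P" "x \<notin> Q"
  shows "cyl P Q (insert x A) = cyl P Q A"
  using assms by (auto simp: cyl_def)

text \<open>Apart from \<open>v\<close> itself, a site inspected at \<open>v\<close> either has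
  smaller rank than \<open>v\<close> or, by truncation, a zero coordinate. In neither case can it be
  \<open>(i, j)\<close>, so adding that site changes nothing at \<open>v\<close>.\<close>

lemma densities_insert_future:
  assumes "v \<noteq> (i, j)" "v \<in> {1..} \<times> {1..}" "fst v + 2 * snd v \<le> i + 2 * j" "i \<ge> 1" "j \<ge> 1"
  shows "low_density v (insert (i, j) A) = low_density v A"
    "high_density v (insert (i, j) A) = high_density v A"
proof -
  obtain a b where v: "v = (a, b)" by fastforce
  have "(i, j) \<noteq> (a - k, b - l)" if "k + l > 0" for k l
    using assms that v by auto
  then have *: "(i, j) \<noteq> (a, b)" "(i, j) \<noteq> (a - 1, b)" "(i, j) \<noteq> (a, b - 1)" "(i, j) \<noteq> (a - 1, b - 1)"
    "(i, j) \<noteq> (a - 2, b)" "(i, j) \<noteq> (a - 2, b - 1)" "(i, j) \<noteq> (a - 2, b - 2)"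
    "(i, j) \<noteq> (a - 1, b - 2)" "(i, j) \<noteq> (a, b - 2)" "(i, j) \<noteq> (a + 1, b - 1)"
    using assms v by auto
  show "low_density v (insert (i, j) A) = low_density v A"
    unfolding v low_density_def prod.case
    using * by (simp add: cyl_insert_future)
  show "high_density v (insert (i, j) A) = high_density v A"
    unfolding v high_density_def prod.case
    using * by (simp add: cyl_insert_future)
qed

text \<open>Every cylinder in the densities requires \<open>v\<close> to be open. Hence sums over
  the random set of open sites may be replaced by sums over a fixed set.\<close>

lemma densities_closed:
  assumes "v \<notin> A"
  shows "low_density v A = 0" "high_density v A = 0"
proof -
  obtain i j where v: "v = (i, j)" by fastforce
  have "cyl (insert (i, j) P) Q A = 0" for P Q
    using assms v by (simp add: cyl_def)
  then show "low_density v A = 0" "high_density v A = 0"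
    by (simp_all add: v low_density_def high_density_def)
qed

text \<open>Sites are added by increasing rank. The densities at earlier sites stay as they were,
  and those at the new site bound the change in the number of clusters.\<close>

lemma card_clusters_between_densities:
  assumes "finite A" "A \<subseteq> {1..} \<times> {1..}"
  shows "(\<Sum>v\<in>A. low_density v A) \<le> card (clusters lattice_adj A) \<and>
    card (clusters lattice_adj A) \<le> (\<Sum>v\<in>A. high_density v A)"
  using assms
proof (induction A rule: finite_ranking_induct[where f = "\<lambda>v. fst v + 2 * snd v"])
  case empty
  then show ?case by (simp add: clusters_def)
next
  case (insert x A)
  obtain i j where x: "x = (i, j)" by fastforce
  \<comment> \<open>The induction rule only gives a weak inequality of ranks and may insert a site
    that is already present.\<close>
  show ?case
  proof (cases "x \<in> A")
    case True
    then show ?thesis using insert by (simp add: insert_absorb)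
  next
    case False
    let ?A = "insert (i, j) A"
    have A: "A \<subseteq> {1..} \<times> {1..}" and pos: "i \<ge> 1" "j \<ge> 1" and new: "(i, j) \<notin> A"
      using insert.prems False x by auto
    have rank: "a + 2 * b \<le> i + 2 * j" if "(a, b) \<in> A" for a b
      using insert.hyps(2)[OF that] x by simp
    have old: "low_density v ?A = low_density v A" "high_density v ?A = high_density v A"
      if "v \<in> A" for v
      using densities_insert_future[of v i j A] that new A pos rank[of "fst v" "snd v"] by auto
    have nin: "(i - 1, j) \<noteq> (i, j)" "(i, j - 1) \<noteq> (i, j)" "(i - 1, j - 1) \<noteq> (i, j)"
      "(i - 2, j) \<noteq> (i, j)" "(i - 2, j - 1) \<noteq> (i, j)" "(i - 2, j - 2) \<noteq> (i, j)"
      "(i - 1, j - 2) \<noteq> (i, j)" "(i, j - 2) \<noteq> (i, j)" "(i + 1, j - 1) \<noteq> (i, j)"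
      using pos by auto
    have low: "low_density (i, j) ?A = 1 - of_bool ((i - 1, j) \<in> A) - of_bool ((i, j - 1) \<in> A)
      + of_bool ((i - 1, j) \<in> A \<and> (i, j - 1) \<in> A \<and> ((i - 1, j - 1) \<in> A \<or>
        {(i - 2, j), (i - 2, j - 1), (i - 2, j - 2), (i - 1, j - 2), (i, j - 2)} \<subseteq> A))"
      using nin by (auto simp: low_density_def cyl_def)
    have high: "high_density (i, j) ?A = 1 - of_bool ((i - 1, j) \<in> A) - of_bool ((i, j - 1) \<in> A)
      + of_bool ((i - 1, j) \<in> A \<and> (i, j - 1) \<in> A \<and> ((i - 1, j - 1) \<in> A \<or>
        (i - 2, j) \<in> A \<and> ((i + 1, j - 1) \<in> A \<or> (i, j - 2) \<in> A)))"
      using nin by (auto simp: high_density_def cyl_def)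
    note step = card_clusters_step[OF insert.hyps(1) new insert.prems[unfolded x] rank]
    \<comment> \<open>\<open>?d\<close> is the exact increment. The densities at the new site
      replace the connection event by a sufficient condition (low) or a necessary one
      (high).\<close>
    let ?conn = "(i - 1, j) \<in> A \<and> (i, j - 1) \<in> A \<and>
      ((i - 1, j), (i, j - 1)) \<in> rtrancl_on A lattice_adj"
    let ?d = "1 - of_bool ((i - 1, j) \<in> A) - of_bool ((i, j - 1) \<in> A) + of_bool ?conn :: real"
    have "low_density (i, j) ?A \<le> ?d"
      unfolding low using past_connection_low[OF new pos A]
      by (intro add_left_mono, unfold of_bool_less_eq_iff) blast
    moreover have "?d \<le> high_density (i, j) ?A"
      unfolding high using past_connection_high[OF new pos A rank]
      by (intro add_left_mono, unfold of_bool_less_eq_iff) blast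
    moreover have "real (card (clusters lattice_adj ?A)) = real (card (clusters lattice_adj A)) + ?d"
      using step by simp
    ultimately show ?thesis
      using insert.IH[OF A] insert.hyps(1) new old unfolding x
      by (simp del: of_bool_eq_1_iff)
  qed
qed

section \<open>Components of the percolated lattice as clusters\<close>

lemma rtrancl_on_Int_Times: "rtrancl_on A (E \<inter> A \<times> A) = rtrancl_on A E"
proof -
  have "(x, y) \<in> rtrancl_on A (E \<inter> A \<times> A)" if "(x, y) \<in> rtrancl_on A E" for x y
    using that by (induction rule: rtrancl_on_induct) (auto intro: rtrancl_on_into_rtrancl_on)
  moreover have "(x, y) \<in> rtrancl_on A E" if "(x, y) \<in> rtrancl_on A (E \<inter> A \<times> A)" for x y
    using that rtrancl_on_mono[of "E \<inter> A \<times> A" E A A] by blast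
  ultimately show ?thesis by auto
qed

text \<open>In a symmetric digraph, mutual reachability is plain reachability, so the vertex sets of
  the strong components are the clusters of the arc relation.\<close>

lemma card_components:
  assumes "sym_digraph G"
  shows "card (components G) = card (clusters (arcs_ends G) (verts G))"
proof -
  interpret sym_digraph G by fact
  have "scc_of u = rtrancl_on (verts G) (arcs_ends G) `` {u}" for u
    using symmetric_reachable'[of u] symmetric_reachable'[of _ u]
    by (auto simp: scc_of_def reachable_def)
  then have "sccs_verts = clusters (arcs_ends G) (verts G)"
    by (simp add: sccs_verts_conv_scc_of clusters_def)
  then show ?thesis
    using components_eq_sccs[OF assms] card_sccs_verts by simp
qed

definition square :: "nat \<Rightarrow> (nat \<times> nat) set" where
  "square n = {1..n} \<times> {1..n}"

lemma finite_square [simp]: "finite (square n)"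
  by (simp add: square_def)

lemma card_components_square_lattice:
  "card (components (open_subgraph (square_lattice n) \<omega>)) = card (clusters lattice_adj {v \<in> square n. \<omega> v})"
proof -
  interpret G: pair_graph "square_lattice n" by (rule pair_graph_square_lattice)
  let ?S = "{v \<in> square n. \<omega> v}"
  have H: "open_subgraph (square_lattice n) \<omega> = with_proj (square_lattice n) \<restriction> ?S"
    by (simp add: open_subgraph_def square_lattice_def square_def)
  have "sym_digraph (with_proj (square_lattice n) \<restriction> ?S)"
    by (intro G.induced_graph_imp_graph G.induced_induce) (auto simp: square_lattice_def square_def)
  moreover have "arcs_ends (with_proj (square_lattice n) \<restriction> ?S) = lattice_adj \<inter> ?S \<times> ?S"
    by (auto simp: arcs_ends_conv square_lattice_def square_def lattice_adj_def image_def)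
  ultimately show ?thesis
    using card_components[of "with_proj (square_lattice n) \<restriction> ?S"]
    by (simp add: H clusters_def rtrancl_on_Int_Times)
qed

section \<open>Mean cluster numbers: subadditivity and translation invariance\<close>

abbreviation site_pmf :: "'a set \<Rightarrow> real \<Rightarrow> ('a \<Rightarrow> bool) pmf" where
  "site_pmf B p \<equiv> Pi_pmf B False (\<lambda>_. bernoulli_pmf p)"

text \<open>General vertex sets are allowed because the tiling argument produces translated squares
  and differences of squares.\<close>

definition mean_clusters :: "(nat \<times> nat) set \<Rightarrow> real \<Rightarrow> real" where
  "mean_clusters B p =
    measure_pmf.expectation (site_pmf B p) (\<lambda>\<omega>. real (card (clusters lattice_adj {v \<in> B. \<omega> v})))"

lemma expected_components_square_lattice:
  "expected_components (square_lattice n) p = mean_clusters (square n) p"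
proof -
  have "verts (square_lattice n) = square n" by (simp add: square_lattice_def square_def)
  then show ?thesis
    by (simp add: expected_components_def mean_clusters_def site_percolation_def
        card_components_square_lattice)
qed

lemma integrable_site_pmf:
  fixes f :: "_ \<Rightarrow> real"
  assumes "finite B"
  shows "integrable (measure_pmf (site_pmf B p)) f"
  using assms by (intro integrable_measure_pmf_finite) (simp add: set_Pi_pmf finite_PiE_dflt)

text \<open>The marginal of a product law on a subset is again the product law. Cluster numbers of
  several regions can thus be compared in one configuration.\<close>

lemma mean_clusters_subset:
  assumes "finite B" "A \<subseteq> B"
  shows "mean_clusters A p = measure_pmf.expectation (site_pmf B p)
    (\<lambda>\<omega>. real (card (clusters lattice_adj {v \<in> A. \<omega> v})))"
proof -
  have "{v \<in> A. if v \<in> A then \<omega> v else False} = {v \<in> A. \<omega> v}" for \<omega> :: "_ \<Rightarrow> bool" by auto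
  then show ?thesis
    by (simp add: mean_clusters_def Pi_pmf_subset[OF assms])
qed

lemma mean_clusters_Un_le:
  assumes "finite A" "finite B"
  shows "mean_clusters (A \<union> B) p \<le> mean_clusters A p + mean_clusters B p"
proof -
  have fin: "finite (A \<union> B)" using assms by simp
  have "mean_clusters (A \<union> B) p \<le> measure_pmf.expectation (site_pmf (A \<union> B) p)
    (\<lambda>\<omega>. real (card (clusters lattice_adj {v \<in> A. \<omega> v})) +
      real (card (clusters lattice_adj {v \<in> B. \<omega> v})))"
    unfolding mean_clusters_def
  proof (intro integral_mono integrable_site_pmf[OF fin])
    fix \<omega> :: "nat \<times> nat \<Rightarrow> bool"
    have "{v \<in> A \<union> B. \<omega> v} = {v \<in> A. \<omega> v} \<union> {v \<in> B. \<omega> v}" by auto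
    then show "real (card (clusters lattice_adj {v \<in> A \<union> B. \<omega> v})) \<le>
      real (card (clusters lattice_adj {v \<in> A. \<omega> v})) + real (card (clusters lattice_adj {v \<in> B. \<omega> v}))"
      using card_clusters_Un_le[OF sym_lattice_adj, of "{v \<in> A. \<omega> v}" "{v \<in> B. \<omega> v}"] assms
      by simp
  qed
  also have "\<dots> = mean_clusters A p + mean_clusters B p"
    using mean_clusters_subset[OF fin, of A] mean_clusters_subset[OF fin, of B]
    by (simp add: Bochner_Integration.integral_add integrable_site_pmf[OF fin])
  finally show ?thesis .
qed

lemma mean_clusters_nonneg: "0 \<le> mean_clusters B p"
  by (simp add: mean_clusters_def)

lemma mean_clusters_le_card:
  assumes "finite B"
  shows "mean_clusters B p \<le> card B"
proof -
  have "card (clusters lattice_adj {v \<in> B. \<omega> v}) \<le> card B" for \<omega>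
    using card_clusters_le[of "{v \<in> B. \<omega> v}" lattice_adj] card_mono[of B "{v \<in> B. \<omega> v}"] assms
    by simp
  then have "mean_clusters B p \<le> measure_pmf.expectation (site_pmf B p) (\<lambda>_. real (card B))"
    unfolding mean_clusters_def by (intro integral_mono integrable_site_pmf[OF assms]) simp_all
  then show ?thesis by simp
qed

lemma mean_clusters_UN_le:
  assumes "finite I" "\<And>i. i \<in> I \<Longrightarrow> finite (f i)"
  shows "mean_clusters (\<Union>i\<in>I. f i) p \<le> (\<Sum>i\<in>I. mean_clusters (f i) p)"
  using assms
proof (induction I rule: finite_induct)
  case empty
  then show ?case using mean_clusters_le_card[of "{}"] by simp
next
  case (insert i I)
  then show ?case
    using mean_clusters_Un_le[of "f i" "\<Union>i\<in>I. f i" p] by fastforce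
qed

text \<open>A translation is an injection that preserves and reflects adjacency, and reindexing the
  sites along it preserves the product law.\<close>

lemma mean_clusters_translate:
  assumes "finite B"
  shows "mean_clusters ((\<lambda>(i, j). (i + a, j + b)) ` B) p = mean_clusters B p"
proof -
  let ?h = "\<lambda>(i, j). (i + a, j + b) :: nat \<times> nat"
  have inj: "inj ?h" by (auto simp: inj_def)
  have "site_pmf B p = map_pmf (\<lambda>g. g \<circ> ?h) (site_pmf (?h ` B) p)"
    using assms inj by (intro Pi_pmf_bij_betw) (auto simp: inj_on_def inj_def bij_betw_def)
  moreover have "card (clusters lattice_adj {v \<in> B. (g \<circ> ?h) v}) =
      card (clusters lattice_adj {v \<in> ?h ` B. g v})" for g
  proof -
    have "{v \<in> ?h ` B. g v} = ?h ` {v \<in> B. (g \<circ> ?h) v}" by auto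
    moreover have "(?h u, ?h v) \<in> lattice_adj \<longleftrightarrow> (u, v) \<in> lattice_adj" for u v
      by (cases u; cases v) (simp add: lattice_adj_iff)
    ultimately show ?thesis using card_clusters_image[OF inj, of lattice_adj] by simp
  qed
  ultimately show ?thesis by (simp add: mean_clusters_def)
qed

section \<open>Tiling of squares and existence of the limit\<close>

lemma square_tiling:
  assumes "m > 0"
  shows "square (k * m) = (\<Union>(a, b)\<in>{..<k} \<times> {..<k}. (\<lambda>(i, j). (i + a * m, j + b * m)) ` square m)"
proof (intro equalityI subsetI)
  fix v assume "v \<in> square (k * m)"
  then obtain i j where v: "v = (i, j)" "i \<in> {1..k * m}" "j \<in> {1..k * m}" by (auto simp: square_def)
  \<comment> \<open>Coordinates start at 1, so \<open>i - 1\<close> is the number to divide by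
    \<open>m\<close> with remainder.\<close>
  have dm: "\<exists>a<k. \<exists>i'\<in>{1..m}. i = i' + a * m" if "i \<in> {1..k * m}" for i
  proof (intro exI bexI conjI)
    show "(i - 1) div m < k" using that assms by (subst div_less_iff_less_mult) auto
    show "(i - 1) mod m + 1 \<in> {1..m}" using assms by (simp add: Suc_le_eq)
    show "i = (i - 1) mod m + 1 + (i - 1) div m * m"
      using that mod_div_mult_eq[of "i - 1" m] by simp
  qed
  obtain a i' b j' where "a < k" "i' \<in> {1..m}" "i = i' + a * m" "b < k" "j' \<in> {1..m}" "j = j' + b * m"
    using dm[OF v(2)] dm[OF v(3)] by blast
  then show "v \<in> (\<Union>(a, b)\<in>{..<k} \<times> {..<k}. (\<lambda>(i, j). (i + a * m, j + b * m)) ` square m)"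
    using v(1) unfolding square_def by force
next
  fix v assume "v \<in> (\<Union>(a, b)\<in>{..<k} \<times> {..<k}. (\<lambda>(i, j). (i + a * m, j + b * m)) ` square m)"
  then obtain a b i j where *: "a < k" "b < k" "i \<in> {1..m}" "j \<in> {1..m}" "v = (i + a * m, j + b * m)"
    by (auto simp: square_def)
  have "i + a * m \<le> k * m" if "a < k" "i \<le> m" for i a
    using that mult_le_mono1[of "Suc a" k m] by simp
  then show "v \<in> square (k * m)" using * by (auto simp: square_def)
qed

text \<open>Subadditivity over \<open>k ^ 2\<close> translated blocks; the sites left over are
  bounded by their number.\<close>

lemma mean_clusters_square_le:
  assumes "m > 0" "k * m \<le> n"
  shows "mean_clusters (square n) p \<le> real k ^ 2 * mean_clusters (square m) p + (real n ^ 2 - real (k * m) ^ 2)"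
proof -
  let ?t = "\<lambda>(a, b). (\<lambda>(i, j). (i + a * m, j + b * m)) ` square m"
  have sub: "square (k * m) \<subseteq> square n" using assms by (auto simp: square_def)
  have "mean_clusters (square n) p \<le> mean_clusters (square (k * m)) p + mean_clusters (square n - square (k * m)) p"
    using mean_clusters_Un_le[of "square (k * m)" "square n - square (k * m)" p] sub by (simp add: Un_absorb1)
  moreover have "mean_clusters (square n - square (k * m)) p \<le> real n ^ 2 - real (k * m) ^ 2"
  proof -
    have "card (square n - square (k * m)) = n ^ 2 - (k * m) ^ 2"
      using sub by (subst card_Diff_subset) (simp_all add: square_def power2_eq_square)
    moreover have "(k * m) ^ 2 \<le> n ^ 2" using assms(2) by (rule power_mono) simp
    ultimately show ?thesis
      using mean_clusters_le_card[of "square n - square (k * m)" p] by (simp add: of_nat_diff)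
  qed
  moreover have "mean_clusters (square (k * m)) p \<le> (\<Sum>c\<in>{..<k} \<times> {..<k}. mean_clusters (?t c) p)"
    unfolding square_tiling[OF assms(1)] by (rule mean_clusters_UN_le) auto
  moreover have "(\<Sum>c\<in>{..<k} \<times> {..<k}. mean_clusters (?t c) p) = real k ^ 2 * mean_clusters (square m) p"
  proof -
    have "mean_clusters (?t c) p = mean_clusters (square m) p" for c
      by (cases c) (simp add: mean_clusters_translate)
    then show ?thesis by (simp add: power2_eq_square)
  qed
  ultimately show ?thesis by linarith
qed

definition max_mean :: "nat \<Rightarrow> real" where
  "max_mean n = (SUP p\<in>{0<..<1}. mean_clusters (square n) p)"

text \<open>The real supremum in \<open>max_mean\<close> is meaningful only for a bounded set; the
  number of sites is a bound uniform in \<open>p\<close>.\<close>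

lemma bdd_above_mean_clusters: "finite B \<Longrightarrow> bdd_above (mean_clusters B ` P)"
  using mean_clusters_le_card by (intro bdd_aboveI2) auto

lemma mean_clusters_le_max: "p \<in> {0<..<1} \<Longrightarrow> mean_clusters (square n) p \<le> max_mean n"
  unfolding max_mean_def by (rule cSUP_upper) (simp_all add: bdd_above_mean_clusters)

lemma max_mean_le: "(\<And>p. p \<in> {0<..<1} \<Longrightarrow> mean_clusters (square n) p \<le> c) \<Longrightarrow> max_mean n \<le> c"
  unfolding max_mean_def by (rule cSUP_least) auto

lemma max_mean_nonneg: "0 \<le> max_mean n"
  using mean_clusters_le_max[of "1/2" n] mean_clusters_nonneg[of "square n" "1/2"] by simp

text \<open>With \<open>k = n div m\<close>, the leftover strip has width less than
  \<open>m\<close>, hence at most \<open>2 * m * n\<close> sites. The block bound holds for each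
  \<open>p\<close>, so it passes to the supremum.\<close>

lemma max_mean_almost_decreasing:
  assumes "m > 0" "n > 0"
  shows "max_mean n / real n ^ 2 \<le> max_mean m / real m ^ 2 + 2 * real m / real n"
proof -
  define k where "k = n div m"
  have km: "k * m \<le> n" "n < k * m + m"
    using dividend_less_div_times[OF assms(1), of n] by (simp_all add: k_def add.commute)
  have "max_mean n \<le> real k ^ 2 * max_mean m + (real n ^ 2 - real (k * m) ^ 2)"
  proof (rule max_mean_le)
    fix p :: real assume "p \<in> {0<..<1}"
    then have "real k ^ 2 * mean_clusters (square m) p \<le> real k ^ 2 * max_mean m"
      by (intro mult_left_mono mean_clusters_le_max) auto
    then show "mean_clusters (square n) p \<le> real k ^ 2 * max_mean m + (real n ^ 2 - real (k * m) ^ 2)"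
      using mean_clusters_square_le[OF assms(1) km(1), of p] by linarith
  qed
  moreover have "real n ^ 2 - real (k * m) ^ 2 \<le> 2 * real m * real n"
  proof -
    have "real n ^ 2 - real (k * m) ^ 2 = (real n - real (k * m)) * (real n + real (k * m))"
      by (simp add: power2_eq_square algebra_simps)
    also have "\<dots> \<le> real m * (real n + real n)"
      using km by (intro mult_mono) (auto simp flip: of_nat_mult)
    finally show ?thesis by simp
  qed
  moreover have "real k ^ 2 * max_mean m \<le> real n ^ 2 / real m ^ 2 * max_mean m"
  proof (rule mult_right_mono[OF _ max_mean_nonneg])
    have "real k * real m \<le> real n" using km(1) by (metis of_nat_le_iff of_nat_mult)
    then have "(real k * real m) ^ 2 \<le> real n ^ 2" by (intro power_mono) auto
    then show "real k ^ 2 \<le> real n ^ 2 / real m ^ 2" using assms by (simp add: field_simps)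
  qed
  ultimately have "max_mean n \<le> real n ^ 2 / real m ^ 2 * max_mean m + 2 * real m * real n" by linarith
  then have "max_mean n / real n ^ 2 \<le> (real n ^ 2 / real m ^ 2 * max_mean m + 2 * real m * real n) / real n ^ 2"
    by (rule divide_right_mono) simp
  also have "\<dots> = max_mean m / real m ^ 2 + 2 * real m / real n"
    using assms by (simp add: field_simps power2_eq_square)
  finally show ?thesis .
qed

text \<open>A Fekete-type argument with the infimum \<open>L\<close> over positive indices as limit:
  some \<open>b m\<close> lies within \<open>e / 2\<close> of \<open>L\<close>, and for large
  \<open>n\<close> the error \<open>2 * m / n\<close> is below \<open>e / 2\<close>.\<close>

lemma convergent_of_almost_decreasing:
  fixes b :: "nat \<Rightarrow> real"
  assumes nonneg: "\<And>n. 0 \<le> b n"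
    and le: "\<And>m n. m > 0 \<Longrightarrow> n > 0 \<Longrightarrow> b n \<le> b m + 2 * real m / real n"
  shows "convergent b"
proof -
  define L where "L = (INF m\<in>{0<..}. b m)"
  have bdd: "bdd_below (b ` {0<..})" using nonneg by (intro bdd_belowI2[of _ 0]) auto
  have "b \<longlonglongrightarrow> L"
  proof (rule LIMSEQ_I)
    fix e :: real assume e: "e > 0"
    have "\<exists>x\<in>b ` {0<..}. x < L + e / 2"
      unfolding L_def using e bdd by (intro cInf_lessD) auto
    then obtain m where m: "m > 0" "b m < L + e / 2" by auto
    obtain N :: nat where N: "4 * real m / e < real N" using reals_Archimedean2 by blast
    have "norm (b n - L) < e" if "n \<ge> Suc N" for n
    proof -
      have n: "n > 0" "4 * real m / e < real n" using that N by auto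
      then have "2 * real m / real n < e / 2" using e by (simp add: field_simps)
      then have "b n < L + e" using le[OF m(1) n(1)] m(2) by linarith
      moreover have "L \<le> b n" unfolding L_def using n bdd by (intro cINF_lower) auto
      ultimately show ?thesis by simp
    qed
    then show "\<exists>no. \<forall>n\<ge>no. norm (b n - L) < e" by blast
  qed
  then show ?thesis by (rule convergentI)
qed

section \<open>Expected densities and the bounds at fixed p\<close>

lemma expectation_cyl:
  assumes "finite B" "P \<subseteq> B" "Q \<subseteq> B" "P \<inter> Q = {}" and p: "p \<in> {0<..<1}"
  shows "measure_pmf.expectation (site_pmf B p) (\<lambda>\<omega>. cyl P Q {v \<in> B. \<omega> v}) = p ^ card P * (1 - p) ^ card Q"
proof -
  \<comment> \<open>\<open>f x\<close> is the indicator of the constraint at the single site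
    \<open>x\<close>, and constantly 1 where there is none. The cylinder indicator is the product of
    these independent factors.\<close>
  define f :: "_ \<Rightarrow> bool \<Rightarrow> real" where
    "f x b = (if x \<in> P then of_bool b else 1) * (if x \<in> Q then of_bool (\<not> b) else 1)" for x b
  have "cyl P Q {v \<in> B. \<omega> v} = (\<Prod>x\<in>B. f x (\<omega> x))" for \<omega>
  proof (cases "P \<subseteq> {v \<in> B. \<omega> v} \<and> Q \<inter> {v \<in> B. \<omega> v} = {}")
    case True
    then have "f x (\<omega> x) = 1" if "x \<in> B" for x using that by (auto simp: f_def)
    then show ?thesis using True by (simp add: cyl_def)
  next
    case False
    then consider x where "x \<in> P" "x \<in> B" "\<not> \<omega> x" | x where "x \<in> Q" "x \<in> B" "\<omega> x"
      using assms(2,3) by blast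
    then obtain x where "x \<in> B" "f x (\<omega> x) = 0" by cases (auto simp: f_def)
    then have "(\<Prod>x\<in>B. f x (\<omega> x)) = 0" using assms(1) by (meson prod_zero)
    then show ?thesis using False by (simp only: cyl_def of_bool_def if_False simp_thms)
  qed
  then have "measure_pmf.expectation (site_pmf B p) (\<lambda>\<omega>. cyl P Q {v \<in> B. \<omega> v}) =
      measure_pmf.expectation (site_pmf B p) (\<lambda>\<omega>. \<Prod>x\<in>B. f x (\<omega> x))"
    by simp
  also have "\<dots> = (\<Prod>x\<in>B. measure_pmf.expectation (bernoulli_pmf p) (f x))"
    by (rule expectation_prod_Pi_pmf)
      (use assms(1) in \<open>auto simp: f_def intro!: integrable_measure_pmf_finite\<close>)
  also have "\<dots> = (\<Prod>x\<in>B. (if x \<in> P then p else 1) * (if x \<in> Q then 1 - p else 1))"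
    using p assms(4) by (intro prod.cong refl) (auto simp: f_def)
  also have "\<dots> = p ^ card P * (1 - p) ^ card Q"
    using assms(1-3) by (simp add: prod.distrib prod.If_cases Int_absorb1 flip: Int_def)
  finally show ?thesis .
qed

definition low_poly :: "real \<Rightarrow> real" where
  "low_poly p = p - 2 * p ^ 2 + p ^ 4 + p ^ 8 * (1 - p)"

definition high_poly :: "real \<Rightarrow> real" where
  "high_poly p = p - 2 * p ^ 2 + p ^ 4 + p ^ 5 * (1 - p) + p ^ 5 * (1 - p) ^ 2"

text \<open>The range from 3 to \<open>n - 1\<close> keeps all inspected sites, with offsets from -2
  to 1, inside the square. Each cylinder then contributes its monomial.\<close>

lemma expectation_densities:
  assumes p: "p \<in> {0<..<1}" and v: "v \<in> {3..n - 1} \<times> {3..n - 1}"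
  shows "measure_pmf.expectation (site_pmf (square n) p) (\<lambda>\<omega>. low_density v {v \<in> square n. \<omega> v}) = low_poly p"
    and "measure_pmf.expectation (site_pmf (square n) p) (\<lambda>\<omega>. high_density v {v \<in> square n. \<omega> v}) = high_poly p"
proof -
  \<comment> \<open>Shifting by 3 turns the truncated differences into sums, so that the simplifier
    can tell the sites apart and count them.\<close>
  obtain i j where ij: "v = (i + 3, j + 3)" "i + 4 \<le> n" "j + 4 \<le> n"
  proof
    show "v = (fst v - 3 + 3, snd v - 3 + 3)" "fst v - 3 + 4 \<le> n" "snd v - 3 + 4 \<le> n"
      using v by auto
  qed
  note fin = finite_square[of n]
  have E: "measure_pmf.expectation (site_pmf (square n) p) (\<lambda>\<omega>. cyl P Q {v \<in> square n. \<omega> v})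
      = p ^ card P * (1 - p) ^ card Q"
    if "P \<subseteq> {i + 1..i + 4} \<times> {j + 1..j + 4}" "Q \<subseteq> {i + 1..i + 4} \<times> {j + 1..j + 4}" "P \<inter> Q = {}" for P Q
  proof (rule expectation_cyl[OF fin _ _ that(3) p])
    have "{i + 1..i + 4} \<times> {j + 1..j + 4} \<subseteq> square n" using ij by (auto simp: square_def)
    then show "P \<subseteq> square n" "Q \<subseteq> square n" using that by blast+
  qed
  note int = integrable_site_pmf[OF fin]
  have idx: "(i + 3 - 1 :: nat) = i + 2" "(i + 3 - 2 :: nat) = i + 1" "(i + 3 + 1 :: nat) = i + 4"
    "(j + 3 - 1 :: nat) = j + 2" "(j + 3 - 2 :: nat) = j + 1"
    by auto
  show "measure_pmf.expectation (site_pmf (square n) p) (\<lambda>\<omega>. low_density v {v \<in> square n. \<omega> v}) = low_poly p"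
    unfolding ij(1) low_density_def prod.case idx
    by (simp add: int E low_poly_def power_numeral_reduce)
  show "measure_pmf.expectation (site_pmf (square n) p) (\<lambda>\<omega>. high_density v {v \<in> square n. \<omega> v}) = high_poly p"
    unfolding ij(1) high_density_def prod.case idx
    by (simp add: int E high_poly_def power_numeral_reduce)
qed

lemma cyl_bounds: "0 \<le> cyl P Q A" "cyl P Q A \<le> 1"
  by (auto simp: cyl_def)

text \<open>Crude bounds suffice near the boundary, where inspected sites may leave the square; the
  number of such \<open>v\<close> is linear in \<open>n\<close>.\<close>

lemma density_bounds: "-2 \<le> low_density v A" "high_density v A \<le> 4"
proof -
  obtain i j where v: "v = (i, j)" by fastforce
  have "-2 \<le> a - b - c + d + e" if "0 \<le> a" "b \<le> 1" "c \<le> 1" "0 \<le> d" "0 \<le> e" for a b c d e :: real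
    using that by linarith
  then show "-2 \<le> low_density v A"
    unfolding v low_density_def prod.case using cyl_bounds by metis
  have "a - b - c + d + e + f \<le> 4" if "a \<le> 1" "0 \<le> b" "0 \<le> c" "d \<le> 1" "e \<le> 1" "f \<le> 1"
    for a b c d e f :: real
    using that by linarith
  then show "high_density v A \<le> 4"
    unfolding v high_density_def prod.case using cyl_bounds by metis
qed

lemma card_square_boundary:
  assumes "n \<ge> 3"
  shows "real (card (square n - {3..n - 1} \<times> {3..n - 1})) = real n ^ 2 - (real n - 3) ^ 2"
proof -
  have "card (square n - {3..n - 1} \<times> {3..n - 1}) = n ^ 2 - (n - 3) ^ 2"
    using assms by (subst card_Diff_subset) (auto simp: square_def power2_eq_square)
  moreover have "(n - 3) ^ 2 \<le> n ^ 2" by (rule power_mono) auto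
  ultimately show ?thesis using assms by (simp add: of_nat_diff)
qed

text \<open>The pointwise bounds are integrated. Interior sites contribute the polynomial exactly,
  boundary sites at least -2 or at most 4 each.\<close>

lemma mean_clusters_between:
  assumes p: "p \<in> {0<..<1}" and n: "n \<ge> 3"
  shows "(real n - 3) ^ 2 * low_poly p - 2 * (real n ^ 2 - (real n - 3) ^ 2) \<le> mean_clusters (square n) p"
    and "mean_clusters (square n) p \<le> (real n - 3) ^ 2 * high_poly p + 4 * (real n ^ 2 - (real n - 3) ^ 2)"
proof -
  let ?I = "{3..n - 1} \<times> {3..n - 1}" and ?A = "\<lambda>\<omega>. {v \<in> square n. \<omega> v}"
  let ?E = "measure_pmf.expectation (site_pmf (square n) p)"
  note fin = finite_square[of n]
  note int = integrable_site_pmf[OF fin]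
  have sub: "?I \<subseteq> square n" by (auto simp: square_def)
  have cardI: "real (card ?I) = (real n - 3) ^ 2"
    using n by (simp add: of_nat_diff power2_eq_square)
  have open_sum: "(\<Sum>v\<in>?A \<omega>. f v (?A \<omega>)) = (\<Sum>v\<in>square n. f v (?A \<omega>))"
    if "\<And>v A. v \<notin> A \<Longrightarrow> f v A = (0 :: real)" for f \<omega>
    by (rule sum.mono_neutral_left) (use that in auto)
  have between: "(\<Sum>v\<in>square n. low_density v (?A \<omega>)) \<le> card (clusters lattice_adj (?A \<omega>))"
    "card (clusters lattice_adj (?A \<omega>)) \<le> (\<Sum>v\<in>square n. high_density v (?A \<omega>))" for \<omega>
  proof -
    have "finite (?A \<omega>)" "?A \<omega> \<subseteq> {1..} \<times> {1..}" by (auto simp: square_def)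
    from card_clusters_between_densities[OF this] show
      "(\<Sum>v\<in>square n. low_density v (?A \<omega>)) \<le> card (clusters lattice_adj (?A \<omega>))"
      "card (clusters lattice_adj (?A \<omega>)) \<le> (\<Sum>v\<in>square n. high_density v (?A \<omega>))"
      using open_sum[of low_density \<omega>] open_sum[of high_density \<omega>] densities_closed by simp_all
  qed
  have split: "(\<Sum>v\<in>square n. g v) = (\<Sum>v\<in>?I. g v) + (\<Sum>v\<in>square n - ?I. g v)" for g :: "_ \<Rightarrow> real"
    using sum.subset_diff[OF sub fin, of g] by simp
  have "(\<Sum>v\<in>square n - ?I. ?E (\<lambda>\<omega>. low_density v (?A \<omega>))) \<ge> (\<Sum>v\<in>square n - ?I. -2)"
    using density_bounds(1) by (intro sum_mono measure_pmf.integral_ge_const int) auto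
  moreover have "(\<Sum>v\<in>?I. ?E (\<lambda>\<omega>. low_density v (?A \<omega>))) = (real n - 3) ^ 2 * low_poly p"
    using expectation_densities(1)[OF p] by (simp only: cardI sum_constant cong: sum.cong)
  moreover have "?E (\<lambda>\<omega>. \<Sum>v\<in>square n. low_density v (?A \<omega>)) \<le> mean_clusters (square n) p"
    unfolding mean_clusters_def by (intro integral_mono int between)
  ultimately show "(real n - 3) ^ 2 * low_poly p - 2 * (real n ^ 2 - (real n - 3) ^ 2) \<le> mean_clusters (square n) p"
    using split[of "\<lambda>v. ?E (\<lambda>\<omega>. low_density v (?A \<omega>))"] card_square_boundary[OF n]
    by (simp add: Bochner_Integration.integral_sum int)
  have "(\<Sum>v\<in>square n - ?I. ?E (\<lambda>\<omega>. high_density v (?A \<omega>))) \<le> (\<Sum>v\<in>square n - ?I. 4)"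
    using density_bounds(2) by (intro sum_mono measure_pmf.integral_le_const int) auto
  moreover have "(\<Sum>v\<in>?I. ?E (\<lambda>\<omega>. high_density v (?A \<omega>))) = (real n - 3) ^ 2 * high_poly p"
    using expectation_densities(2)[OF p] by (simp only: cardI sum_constant cong: sum.cong)
  moreover have "mean_clusters (square n) p \<le> ?E (\<lambda>\<omega>. \<Sum>v\<in>square n. high_density v (?A \<omega>))"
    unfolding mean_clusters_def by (intro integral_mono int between)
  ultimately show "mean_clusters (square n) p \<le> (real n - 3) ^ 2 * high_poly p + 4 * (real n ^ 2 - (real n - 3) ^ 2)"
    using split[of "\<lambda>v. ?E (\<lambda>\<omega>. high_density v (?A \<omega>))"] card_square_boundary[OF n]
    by (simp add: Bochner_Integration.integral_sum int)
qed

section \<open>Numerical estimates and conclusion\<close>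

text \<open>The two last summands equal \<open>p ^ 5 * (1 - p) * (2 - p)\<close>. Up to
  \<open>4 / 5\<close> they are at most \<open>2 / 5 * p ^ 4\<close>, which leaves a quartic. That
  quartic is too large near 1, so beyond \<open>4 / 5\<close> the factor \<open>p * (1 - p)\<close>,
  at most \<open>1 / 5\<close>, is used instead.\<close>

lemma high_poly_le:
  assumes "p \<in> {0<..<1}"
  shows "high_poly p \<le> 663 / 5000"
proof (cases "p \<le> 4 / 5")
  case True
  have cubic: "p * (1 - p) * (2 - p) \<le> 2 / 5"
  proof -
    \<comment> \<open>The centre is close to the maximiser of the cubic, about 0.4226.\<close>
    define s where "s = p - 2 / 5"
    have "0 \<le> s ^ 2 * (3 / 5 - s)" using assms by (intro mult_nonneg_nonneg) (auto simp: s_def)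
    moreover have "2 / 5 - p * (1 - p) * (2 - p) = s ^ 2 * (3 / 5 - s) + (6 / 5 * (s - 1 / 30) ^ 2 + 11 / 750)"
      by (simp add: s_def power2_eq_square field_simps)
    ultimately have "0 \<le> 2 / 5 - p * (1 - p) * (2 - p)" by simp
    then show ?thesis by simp
  qed
  have quartic: "p - 2 * p ^ 2 + 7 / 5 * p ^ 4 \<le> 663 / 5000"
  proof -
    \<comment> \<open>The centre is close to the critical point of the quartic, about 0.281.
      Expanded there, the terms of order two and higher of the difference form
      \<open>t * s ^ 2\<close>. A share \<open>1 / 10 * s ^ 2\<close> is set aside to complete the
      square with the small linear term.\<close>
    define s where "s = p - 7 / 25"
    define t where "t = 4192 / 3125 - 196 / 125 * s - 7 / 5 * s ^ 2"
    \<comment> \<open>The factors are \<open>p\<close> and \<open>4 / 5 - p\<close>. The product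
      bounds \<open>s ^ 2\<close> by a linear term, which makes the estimate of \<open>t\<close>
      linear.\<close>
    have "0 \<le> (s + 7 / 25) * (13 / 25 - s)" and s_le: "0 \<le> 13 / 25 - s"
      using assms True by (auto simp: s_def)
    moreover have "(s + 7 / 25) * (13 / 25 - s) = 91 / 625 + 6 / 25 * s - s ^ 2"
      by (simp add: power2_eq_square field_simps)
    ultimately have "0 \<le> 91 / 625 + 6 / 25 * s - s ^ 2" by simp
    then have "1 / 10 \<le> t"
      using s_le unfolding t_def by linarith
    then have "0 \<le> (t - 1 / 10) * s ^ 2" by simp
    moreover have "663 / 5000 - (p - 2 * p ^ 2 + 7 / 5 * p ^ 4) =
        (t - 1 / 10) * s ^ 2 + (1 / 10 * (s - 229 / 15625) ^ 2 + 7552111 / 9765625000)"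
      by (simp add: s_def t_def power_numeral_reduce field_simps)
    ultimately have "0 \<le> 663 / 5000 - (p - 2 * p ^ 2 + 7 / 5 * p ^ 4)" by simp
    then show ?thesis by simp
  qed
  have "p ^ 4 * (p * (1 - p) * (2 - p)) \<le> p ^ 4 * (2 / 5)"
    by (intro mult_left_mono cubic) simp
  moreover have "high_poly p = p - 2 * p ^ 2 + p ^ 4 + p ^ 4 * (p * (1 - p) * (2 - p))"
    by (simp add: high_poly_def power_numeral_reduce algebra_simps)
  ultimately show ?thesis using quartic by linarith
next
  case False
  have "p ^ 4 * (2 - p) \<le> p * (2 - p)"
    using assms power_decreasing[of 1 4 p] by (intro mult_right_mono) auto
  also have "\<dots> = 1 - (1 - p) ^ 2" by (simp add: power2_eq_square algebra_simps)
  also have "\<dots> \<le> 1" by simp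
  finally have "p ^ 4 * (2 - p) \<le> 1" .
  moreover have "4 / 5 * (4 / 5) \<le> p * p" using False by (intro mult_mono) auto
  then have "16 / 25 \<le> p ^ 2" by (simp add: power2_eq_square)
  ultimately have "1 - p - p ^ 2 + p ^ 4 * (2 - p) \<le> 14 / 25"
    using False by simp
  moreover have "0 \<le> p * (1 - p)" using assms by simp
  moreover have "p * (1 - p) \<le> 1 * (1 / 5)" using assms False by (intro mult_mono) auto
  ultimately have "p * (1 - p) * (1 - p - p ^ 2 + p ^ 4 * (2 - p)) \<le> (1 / 5) * 14 / 25"
    using mult_left_mono[of _ "14 / 25" "p * (1 - p)"] by fastforce
  moreover have "high_poly p = p * (1 - p) * (1 - p - p ^ 2 + p ^ 4 * (2 - p))"
    by (simp add: high_poly_def power_numeral_reduce algebra_simps)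
  ultimately show ?thesis by simp
qed

text \<open>The point is close to the maximiser of \<open>low_poly\<close>. The summand
  \<open>p ^ 8 * (1 - p)\<close> is decisive: the others give only about 0.129514.\<close>

lemma low_poly_gt: "low_poly (27 / 100) > 0.12953"
  by (simp add: low_poly_def power_numeral_reduce)

theorem theorem2:
  shows "\<exists>L :: real.
    (\<lambda>n :: nat. (SUP p\<in>{0<..<1}. expected_components (square_lattice n) p) / real (n ^ 2))
      \<longlonglongrightarrow> L \<and> L \<in> {0.12953<..<0.13268}"
proof -
  define b where "b n = max_mean n / real n ^ 2" for n
  have "convergent b"
    unfolding b_def
    by (rule convergent_of_almost_decreasing) (auto simp: max_mean_nonneg max_mean_almost_decreasing)
  then obtain L where L: "b \<longlonglongrightarrow> L" by (auto simp: convergent_def)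
  have inv: "(\<lambda>n. c + d / real n) \<longlonglongrightarrow> c" for c d :: real
    using tendsto_add[OF tendsto_const lim_const_over_n[of d]] by simp
  have boundary: "real n ^ 2 - (real n - 3) ^ 2 \<le> 6 * real n" for n
    by (simp add: power2_eq_square algebra_simps)
  \<comment> \<open>The products are abstracted to variables to keep the arithmetic linear. The
    constant 24 is 4 per boundary site times \<open>6 * n\<close> sites.\<close>
  have lin: "m \<le> 663 / 5000 * x + 24 * y"
    if "a \<le> x * (663 / 5000)" "m \<le> a + 4 * d" "d \<le> 6 * y" for a d m x y :: real
    using that by linarith
  have upper: "b n \<le> 663 / 5000 + 24 / real n" if "n \<ge> 3" for n
  proof -
    have "max_mean n \<le> 663 / 5000 * real n ^ 2 + 24 * real n"
    proof (rule max_mean_le)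
      fix p :: real assume p: "p \<in> {0<..<1}"
      have "(real n - 3) ^ 2 * high_poly p \<le> (real n - 3) ^ 2 * (663 / 5000)"
        by (intro mult_left_mono high_poly_le p) simp
      also have "\<dots> \<le> real n ^ 2 * (663 / 5000)"
        using that by (intro mult_right_mono power_mono) auto
      finally have *: "(real n - 3) ^ 2 * high_poly p \<le> real n ^ 2 * (663 / 5000)" .
      show "mean_clusters (square n) p \<le> 663 / 5000 * real n ^ 2 + 24 * real n"
        by (rule lin[OF * mean_clusters_between(2)[OF p that] boundary])
    qed
    then have "b n \<le> (663 / 5000 * real n ^ 2 + 24 * real n) / real n ^ 2"
      unfolding b_def by (rule divide_right_mono) simp
    also have "\<dots> = 663 / 5000 + 24 / real n" using that by (simp add: field_simps power2_eq_square)
    finally show ?thesis .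
  qed
  \<comment> \<open>The constant 18 is \<open>6 + 2 * 6\<close>: the cost of replacing
    \<open>(n - 3) ^ 2\<close> by \<open>n ^ 2\<close>, where \<open>low_poly (27 / 100)\<close> is
    at most 1, plus 2 per boundary site.\<close>
  have lin': "x - 18 * y \<le> m"
    if "e \<le> 6 * y * 1" "e = x - z" "z - 2 * d \<le> k" "k \<le> m" "d \<le> 6 * y" for d e k m x y z :: real
    using that by linarith
  have lower: "low_poly (27 / 100) + (- 18) / real n \<le> b n" if "n \<ge> 3" for n
  proof -
    have "low_poly (27 / 100) \<le> 1" by (simp add: low_poly_def power_numeral_reduce)
    then have "(real n ^ 2 - (real n - 3) ^ 2) * low_poly (27 / 100) \<le> (6 * real n) * 1"
      using low_poly_gt boundary[of n] by (intro mult_mono) auto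
    moreover have "(real n ^ 2 - (real n - 3) ^ 2) * low_poly (27 / 100) =
        real n ^ 2 * low_poly (27 / 100) - (real n - 3) ^ 2 * low_poly (27 / 100)"
      by (simp add: left_diff_distrib)
    moreover have "(real n - 3) ^ 2 * low_poly (27 / 100) - 2 * (real n ^ 2 - (real n - 3) ^ 2)
        \<le> mean_clusters (square n) (27 / 100)"
      using that by (intro mean_clusters_between) auto
    moreover have "mean_clusters (square n) (27 / 100) \<le> max_mean n" by (rule mean_clusters_le_max) simp
    ultimately have "real n ^ 2 * low_poly (27 / 100) - 18 * real n \<le> max_mean n"
      using boundary[of n] by (rule lin')
    then have "(real n ^ 2 * low_poly (27 / 100) - 18 * real n) / real n ^ 2 \<le> b n"
      unfolding b_def by (rule divide_right_mono) simp
    moreover have "(real n ^ 2 * low_poly (27 / 100) - 18 * real n) / real n ^ 2 = low_poly (27 / 100) + (- 18) / real n"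
      using that by (simp add: field_simps power2_eq_square)
    ultimately show ?thesis by simp
  qed
  \<comment> \<open>Limits preserve only weak inequalities; strictness comes from
    \<open>663 / 5000 < 0.13268\<close> and \<open>low_poly_gt\<close>.\<close>
  have "L \<le> 663 / 5000" by (rule LIMSEQ_le[OF L inv]) (use upper in blast)
  moreover have "low_poly (27 / 100) \<le> L" by (rule LIMSEQ_le[OF inv L]) (use lower in blast)
  ultimately have "L \<in> {0.12953<..<0.13268}" using low_poly_gt by simp
  moreover have "b = (\<lambda>n. (SUP p\<in>{0<..<1}. expected_components (square_lattice n) p) / real (n ^ 2))"
    by (simp add: b_def fun_eq_iff max_mean_def expected_components_square_lattice)
  ultimately show ?thesis using L by metis
qed

end
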